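(* Let $M_n$ be the algebra of all $n\times n$ complex matrices and let $A,X\in M_n$. Then $X$ is the dual core inverse of $A$ if and only if $AXA=A$, $XM_n=A^*M_n$ and $M_nX=M_nA$.
   Context: Here $A^*$ is the conjugate transpose, $AM_n=\{AZ:Z\in M_n\}$, $M_nA=\{ZA:Z\in M_n\}$, and $\mathcal R(A)$ is the range (column space) of $A$. A matrix $X\in M_n$ is the dual core inverse of $A\in M_n$ if $XA=P_{A^*}$ and $\mathcal R(X^* )\subseteq\mathcal R(A^* )$, where $P_{A^*}$ is the orthogonal projection onto $\mathcal R(A^* )$. *)

theory Defs
  imports "Jordan_Normal_Form.Schur_Decomposition" "Jordan_Normal_Form.VS_Connect"
begin

text \<open>\<^term>\<open>v \<bullet>c w\<close> is the Hermitian inner product of \<open>\<complex>\<^sup>n\<close>.  When \<open>S\<close> is a subspace, at most one matrix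
  satisfies the following predicate (lemma \<open>is_orthogonal_projection_unique\<close>).\<close>

definition is_orthogonal_projection :: "nat \<Rightarrow> complex vec set \<Rightarrow> complex mat \<Rightarrow> bool" where
  "is_orthogonal_projection n S P \<longleftrightarrow>
     P \<in> carrier_mat n n \<and>
     (\<forall>v \<in> carrier_vec n. P *\<^sub>v v \<in> S \<and> (\<forall>w \<in> S. (v - P *\<^sub>v v) \<bullet>c w = 0))"

definition is_dual_core_inverse :: "nat \<Rightarrow> complex mat \<Rightarrow> complex mat \<Rightarrow> bool" where
  "is_dual_core_inverse n A X \<longleftrightarrow>
     X \<in> carrier_mat n n \<and>
     is_orthogonal_projection n (vec_space.col_space n (mat_adjoint A)) (X * A) \<and>
     vec_space.col_space n (mat_adjoint X) \<subseteq> vec_space.col_space n (mat_adjoint A)"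

lemma is_orthogonal_projection_unique:
  assumes S: "S \<subseteq> carrier_vec n" "\<And>u v. u \<in> S \<Longrightarrow> v \<in> S \<Longrightarrow> u - v \<in> S"
    and P: "is_orthogonal_projection n S P" and Q: "is_orthogonal_projection n S Q"
  shows "P = Q"
proof -
  have dims: "P \<in> carrier_mat n n" "Q \<in> carrier_mat n n"
    using P Q by (auto simp: is_orthogonal_projection_def)
  have eq: "P *\<^sub>v v = Q *\<^sub>v v" if v: "v \<in> carrier_vec n" for v
  proof -
    let ?d = "P *\<^sub>v v - Q *\<^sub>v v"
    have Pv: "P *\<^sub>v v \<in> carrier_vec n" and Qv: "Q *\<^sub>v v \<in> carrier_vec n"
      using dims v by auto
    have d: "?d \<in> S" "?d \<in> carrier_vec n"
      using P Q v S by (auto simp: is_orthogonal_projection_def)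
    have "?d = (v - Q *\<^sub>v v) - (v - P *\<^sub>v v)"
    proof -
      have "p - q = (v - q) - (v - p)" if "p \<in> carrier_vec n" "q \<in> carrier_vec n" for p q :: "complex vec"
        using v that by (intro eq_vecI) auto
      then show ?thesis using Pv Qv by blast
    qed
    then have "?d \<bullet>c ?d = ((v - Q *\<^sub>v v) - (v - P *\<^sub>v v)) \<bullet>c ?d"
      by simp
    also have "\<dots> = (v - Q *\<^sub>v v) \<bullet>c ?d - (v - P *\<^sub>v v) \<bullet>c ?d"
      using v Pv Qv by (intro minus_scalar_prod_distrib[of _ n]) auto
    also have "\<dots> = 0"
      using P Q v d by (simp add: is_orthogonal_projection_def)
    finally have "?d = 0\<^sub>v n"
      using d(2) conjugate_square_eq_0_vec by blast
    moreover have "p = q" if "p - q = 0\<^sub>v n" "p \<in> carrier_vec n" "q \<in> carrier_vec n" for p q :: "complex vec"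
    proof (rule eq_vecI)
      fix i assume "i < dim_vec q"
      then have "i < n" using that by simp
      then have "(p - q) $ i = 0" using that(1) by simp
      moreover have "(p - q) $ i = p $ i - q $ i" using \<open>i < n\<close> that(3) by auto
      ultimately show "p $ i = q $ i" by simp
    qed (use that in auto)
    ultimately show ?thesis using Pv Qv by blast
  qed
  show ?thesis
  proof (rule eq_matI)
    fix i j assume "i < dim_row Q" "j < dim_col Q"
    then have ij: "i < n" "j < n" using dims by auto
    have "(P *\<^sub>v unit_vec n j) $ i = (Q *\<^sub>v unit_vec n j) $ i"
      by (simp add: eq)
    then show "P $$ (i, j) = Q $$ (i, j)"
      using ij dims by auto
  qed (use dims in auto)
qed

end

theory Submission
  imports Defs
begin

text \<open>Write \<open>P = XA\<close>.  If \<open>X\<close> is the dual core inverse, then \<open>AP = A\<close> since \<open>P\<close> projects orthogonally along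
  the kernel of \<open>A\<close>; moreover \<open>X = EA\<close> for some \<open>E\<close>, so \<open>XP = X\<close>, and \<open>P = P\<^sup>*\<close>.  In the corner algebra
  \<open>P M\<^sub>n P\<close> the elements \<open>PX\<close> and \<open>PA\<close> satisfy \<open>(PX)(PA) = P\<close>, and one-sided inverses there are two-sided
  because \<open>n\<close> is finite.  The resulting identity \<open>(PA)(PX) = P\<close> gives \<open>A = A\<^sup>2X\<close> and \<open>X = PX\<close>, hence the
  equalities of ideals.  Conversely, \<open>X = A\<^sup>*B\<close> puts the range of \<open>P\<close> into that of \<open>A\<^sup>*\<close>, \<open>AP = A\<close> makes
  \<open>v - Pv\<close> orthogonal to it, and \<open>X = EA\<close> puts the range of \<open>X\<^sup>*\<close> into it.\<close>

lemma dim_mat_adjoint [simp]: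
  "dim_row (mat_adjoint A) = dim_col A" "dim_col (mat_adjoint A) = dim_row A"
  by (simp_all add: mat_adjoint_def)

lemma mat_adjoint_carrier [simp]:
  "A \<in> carrier_mat n m \<Longrightarrow> mat_adjoint A \<in> carrier_mat m n"
  by (auto intro!: carrier_matI)

lemma index_mat_adjoint:
  assumes "A \<in> carrier_mat n m" "i < m" "j < n"
  shows "mat_adjoint A $$ (i, j) = conjugate (A $$ (j, i))"
  using assms unfolding mat_adjoint_def by (auto simp: mat_of_rows_index)

lemma mat_adjoint_mat_adjoint:
  assumes "A \<in> carrier_mat n m"
  shows "mat_adjoint (mat_adjoint A) = A"
proof (rule eq_matI)
  have B: "mat_adjoint A \<in> carrier_mat m n" using assms by simp
  show "dim_row (mat_adjoint (mat_adjoint A)) = dim_row A" "dim_col (mat_adjoint (mat_adjoint A)) = dim_col A"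
    by simp_all
  fix i j assume "i < dim_row A" "j < dim_col A"
  then show "mat_adjoint (mat_adjoint A) $$ (i, j) = A $$ (i, j)"
    using assms index_mat_adjoint[OF B, of i j] index_mat_adjoint[OF assms, of j i] by auto
qed

lemma mat_adjoint_mult:
  fixes A B :: "'a::conjugatable_field mat"
  assumes "A \<in> carrier_mat n m" "B \<in> carrier_mat m k"
  shows "mat_adjoint (A * B) = mat_adjoint B * mat_adjoint A"
proof (rule eq_matI)
  have AB: "A * B \<in> carrier_mat n k" using assms by simp
  have C: "mat_adjoint (A * B) \<in> carrier_mat k n" using AB by simp
  have A': "mat_adjoint A \<in> carrier_mat m n" and B': "mat_adjoint B \<in> carrier_mat k m" 
    using assms by auto
  show "dim_row (mat_adjoint (A * B)) = dim_row (mat_adjoint B * mat_adjoint A)"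
    "dim_col (mat_adjoint (A * B)) = dim_col (mat_adjoint B * mat_adjoint A)"
    using C A' B' by auto
  fix i j assume "i < dim_row (mat_adjoint B * mat_adjoint A)" "j < dim_col (mat_adjoint B * mat_adjoint A)"
  then have ij: "i < k" "j < n" using A' B' by auto
  have "mat_adjoint (A * B) $$ (i, j) = conjugate (\<Sum>l<m. A $$ (j, l) * B $$ (l, i))"
    using ij assms by (simp add: index_mat_adjoint[OF AB] scalar_prod_def atLeast0LessThan)
  also have "\<dots> = (\<Sum>l<m. mat_adjoint B $$ (i, l) * mat_adjoint A $$ (l, j))"
    using ij assms by (simp add: conjugate_dist_mul mult.commute sum_conjugate
        index_mat_adjoint[OF assms(1)] index_mat_adjoint[OF assms(2)])
  also have "\<dots> = (mat_adjoint B * mat_adjoint A) $$ (i, j)"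
    using ij assms by (auto simp: scalar_prod_def atLeast0LessThan row_def col_def intro!: sum.cong)
  finally show "mat_adjoint (A * B) $$ (i, j) = (mat_adjoint B * mat_adjoint A) $$ (i, j)" .
qed

text \<open>Both sides expand to the same double sum, with the order of summation exchanged. This
  turns orthogonality to the range of \<open>mat_adjoint A\<close> into vanishing under
  \<open>A\<close>, and back.\<close>

lemma cscalar_prod_mat_adjoint:
  fixes A :: "complex mat"
  assumes A: "A \<in> carrier_mat n m" and u: "u \<in> carrier_vec m" and y: "y \<in> carrier_vec n"
  shows "u \<bullet>c (mat_adjoint A *\<^sub>v y) = (A *\<^sub>v u) \<bullet>c y"
proof -
  have A': "mat_adjoint A \<in> carrier_mat m n" using A by simp
  have "u \<bullet>c (mat_adjoint A *\<^sub>v y) = (\<Sum>i<m. \<Sum>j<n. u $ i * (A $$ (j, i) * conjugate (y $ j)))"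
    using A A' u y
    by (auto simp: scalar_prod_def atLeast0LessThan sum_conjugate conjugate_dist_mul row_def
        index_mat_adjoint[OF A] sum_distrib_left intro!: sum.cong)
  also have "\<dots> = (\<Sum>j<n. \<Sum>i<m. u $ i * (A $$ (j, i) * conjugate (y $ j)))"
    by (rule sum.swap)
  also have "\<dots> = (A *\<^sub>v u) \<bullet>c y"
    using A u y
    by (auto simp: scalar_prod_def atLeast0LessThan sum_distrib_left mult_ac intro!: sum.cong)
  finally show ?thesis .
qed

lemma mem_col_space_iff:
  assumes "N \<in> carrier_mat n m"
  shows "y \<in> vec_space.col_space n (N :: 'a::field mat) \<longleftrightarrow> (\<exists>x \<in> carrier_vec m. y = N *\<^sub>v x)"
  using assms by (auto simp: vec_space.col_space_eq[OF assms])

text \<open>The columns of \<open>B\<close> are chosen preimages under \<open>N\<close> of the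
  columns of \<open>M\<close>. This turns range inclusions into matrix equations.\<close>

lemma mat_factor_if_range_subset:
  fixes M N :: "'a::field mat"
  assumes M: "M \<in> carrier_mat n k" and N: "N \<in> carrier_mat n m"
    and sub: "\<And>v. v \<in> carrier_vec k \<Longrightarrow> M *\<^sub>v v \<in> vec_space.col_space n N"
  obtains B where "B \<in> carrier_mat m k" "M = N * B"
proof -
  have "\<forall>j. \<exists>x \<in> carrier_vec m. M *\<^sub>v unit_vec k j = N *\<^sub>v x"
    using sub mem_col_space_iff[OF N] by (meson unit_vec_carrier)
  then obtain f where f: "\<And>j. f j \<in> carrier_vec m" "\<And>j. M *\<^sub>v unit_vec k j = N *\<^sub>v f j"
    by metis
  define B where "B = mat m k (\<lambda>(i, j). f j $ i)"
  have B: "B \<in> carrier_mat m k" by (simp add: B_def)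
  have "M = N * B"
  proof (rule eq_matI)
    fix i j assume "i < dim_row (N * B)" "j < dim_col (N * B)"
    then have ij: "i < n" "j < k" using N B by auto
    have "col B j = f j" using ij f(1)[of j] by (intro eq_vecI) (auto simp: B_def)
    moreover have "(M *\<^sub>v unit_vec k j) $ i = M $$ (i, j)" using ij M by simp
    ultimately show "M $$ (i, j) = (N * B) $$ (i, j)" using ij N B f(2)[of j] by simp
  qed (use M N B in auto)
  with B that show ?thesis by blast
qed

text \<open>Adding the complementary idempotent \<open>1 - P\<close> to \<open>K\<close> and to
  \<open>L\<close> turns inverses relative to \<open>P\<close> into inverses relative to the
  identity, where one-sided inverses of square matrices are two-sided.\<close>

lemma corner_inverse_commute:
  fixes P K L :: "'a::field mat"
  assumes C: "P \<in> carrier_mat n n" "K \<in> carrier_mat n n" "L \<in> carrier_mat n n"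
    and P: "P * P = P" and K: "P * K = K" "K * P = K" and L: "P * L = L" "L * P = L"
    and KL: "K * L = P"
  shows "L * K = P"
proof -
  let ?Q = "1\<^sub>m n - P"
  have Q: "?Q \<in> carrier_mat n n" using C by (intro minus_carrier_mat)
  have PQ: "?Q * P = 0\<^sub>m n n" "P * ?Q = 0\<^sub>m n n"
    using C P by (simp_all add: minus_mult_distrib_mat[of _ n n _ _ n] mult_minus_distrib_mat[of _ n n _ n])
  \<comment> \<open>The cross terms vanish because \<open>Y = Y * P\<close> and
    \<open>Z = P * Z\<close>, while \<open>?Q\<close> is idempotent.\<close>
  have prod: "(Y + ?Q) * (Z + ?Q) = Y * Z + ?Q"
    if Y: "Y \<in> carrier_mat n n" "P * Y = Y" "Y * P = Y" and Z: "Z \<in> carrier_mat n n" "P * Z = Z" "Z * P = Z" for Y Z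
  proof -
    have "Y * ?Q = 0\<^sub>m n n"
      using C Y by (simp add: mult_minus_distrib_mat[of _ n n _ n])
    moreover have "?Q * Z = 0\<^sub>m n n"
      using C Z by (simp add: minus_mult_distrib_mat[of _ n n _ _ n])
    moreover have "?Q * ?Q = ?Q"
    proof -
      have "?Q * ?Q = 1\<^sub>m n * ?Q - P * ?Q"
        using C Q by (intro minus_mult_distrib_mat[of _ n n _ _ n]) auto
      also have "\<dots> = ?Q" unfolding PQ using C by (auto simp: left_mult_one_mat[OF Q] intro!: eq_matI)
      finally show ?thesis .
    qed
    ultimately show ?thesis
      using Y Z Q C by (simp add: add_mult_distrib_mat[of _ n n _ _ n] mult_add_distrib_mat[of _ n n _ n])
  qed
  have one: "P + ?Q = 1\<^sub>m n" using C by (auto intro!: eq_matI)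
  have "(K + ?Q) * (L + ?Q) = 1\<^sub>m n"
    using prod[OF C(2) K C(3) L] KL one by simp
  then have "(L + ?Q) * (K + ?Q) = 1\<^sub>m n"
    using C Q by (intro mat_mult_left_right_inverse[of "K + ?Q" n]) auto
  then have eq: "L * K + ?Q = 1\<^sub>m n"
    using prod[OF C(3) L C(2) K] by simp
  have "L * K = (L * K + ?Q) - ?Q" using C by (auto intro!: eq_matI)
  also have "\<dots> = P" unfolding eq using C by (auto intro!: eq_matI)
  finally show ?thesis .
qed

lemma right_ideal_subset:
  fixes M N :: "'a::field mat"
  assumes "N \<in> carrier_mat n n" "B \<in> carrier_mat n n" "M = N * B"
  shows "{M * Z | Z. Z \<in> carrier_mat n n} \<subseteq> {N * Z | Z. Z \<in> carrier_mat n n}"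
proof safe
  fix Z :: "'a mat" assume "Z \<in> carrier_mat n n"
  then show "\<exists>Y. M * Z = N * Y \<and> Y \<in> carrier_mat n n"
    using assms by (intro exI[of _ "B * Z"]) (auto simp: assoc_mult_mat[of _ n n _ n _ n])
qed

lemma left_ideal_subset:
  fixes M N :: "'a::field mat"
  assumes "N \<in> carrier_mat n n" "B \<in> carrier_mat n n" "M = B * N"
  shows "{Z * M | Z. Z \<in> carrier_mat n n} \<subseteq> {Z * N | Z. Z \<in> carrier_mat n n}"
proof safe
  fix Z :: "'a mat" assume "Z \<in> carrier_mat n n"
  then show "\<exists>Y. Z * M = Y * N \<and> Y \<in> carrier_mat n n"
    using assms by (intro exI[of _ "Z * B"]) (auto simp: assoc_mult_mat[of _ n n _ n _ n])
qed

theorem lemma2p2: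
  fixes A X :: "complex mat" and n :: nat
  assumes "A \<in> carrier_mat n n" and "X \<in> carrier_mat n n"
  shows "is_dual_core_inverse n A X \<longleftrightarrow>
    A * X * A = A \<and>
    {X * Z | Z. Z \<in> carrier_mat n n} = {mat_adjoint A * Z | Z. Z \<in> carrier_mat n n} \<and>
    {Z * X | Z. Z \<in> carrier_mat n n} = {Z * A | Z. Z \<in> carrier_mat n n}"
    (is "?L \<longleftrightarrow> ?R")
proof
  note A = assms(1) and X = assms(2)
  note assoc = assoc_mult_mat[of _ n n _ n _ n]
  let ?A' = "mat_adjoint A" and ?X' = "mat_adjoint X" and ?P = "X * A"
  have A': "?A' \<in> carrier_mat n n" and X': "?X' \<in> carrier_mat n n" and P: "?P \<in> carrier_mat n n"
    using A X by auto
  {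
    assume ?L
    then have orth: "\<And>v. v \<in> carrier_vec n \<Longrightarrow> ?P *\<^sub>v v \<in> vec_space.col_space n ?A'"
        "\<And>v w. v \<in> carrier_vec n \<Longrightarrow> w \<in> vec_space.col_space n ?A' \<Longrightarrow> (v - ?P *\<^sub>v v) \<bullet>c w = 0"
      and sub: "vec_space.col_space n ?X' \<subseteq> vec_space.col_space n ?A'"
      unfolding is_dual_core_inverse_def is_orthogonal_projection_def by auto
    obtain B where B: "B \<in> carrier_mat n n" "?P = ?A' * B"
      by (rule mat_factor_if_range_subset[OF P A' orth(1)])
    \<comment> \<open>Adjoints of this factorization give \<open>X = E * A\<close> with
      \<open>E\<close> the adjoint of \<open>D\<close>.\<close>
    obtain D where D: "D \<in> carrier_mat n n" "?X' = ?A' * D"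
      by (rule mat_factor_if_range_subset[OF X' A']) (use sub mem_col_space_iff[OF X'] in blast)+
    define E where "E = mat_adjoint D"
    have E: "E \<in> carrier_mat n n" using D(1) by (simp add: E_def)
    have XE: "X = E * A"
      using arg_cong[OF D(2), of mat_adjoint] mat_adjoint_mult[OF A' D(1)]
        mat_adjoint_mat_adjoint[OF A] mat_adjoint_mat_adjoint[OF X]
      by (simp add: E_def)
    \<comment> \<open>A separate constant keeps \<open>X * A\<close> together when products are
      reassociated to the right.\<close>
    define P where "P = ?P"
    have Pc: "P \<in> carrier_mat n n" using P by (simp add: P_def)
    have AP: "A * P = A"
    proof (rule eq_matI)
      fix i j assume "i < dim_row A" "j < dim_col A"
      then have ij: "i < n" "j < n" using A by auto
      let ?v = "unit_vec n j :: complex vec"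
      let ?u = "?v - P *\<^sub>v ?v"
      have v: "?v \<in> carrier_vec n" by simp
      have Pv: "P *\<^sub>v ?v \<in> carrier_vec n" using Pc v by (rule mult_mat_vec_carrier)
      have u: "?u \<in> carrier_vec n" using v Pv by (rule minus_carrier_vec)
      have Au: "A *\<^sub>v ?u \<in> carrier_vec n" using A u by (rule mult_mat_vec_carrier)
      \<comment> \<open>The squared norm of \<open>A u\<close> is the product of
        \<open>u = v - P v\<close> with a vector in the range of \<open>?A'\<close>, hence zero.
        Letting \<open>v\<close> run through the unit vectors compares \<open>A * P\<close> and
        \<open>A\<close> entrywise.\<close>
      have "(A *\<^sub>v ?u) \<bullet>c (A *\<^sub>v ?u) = ?u \<bullet>c (?A' *\<^sub>v (A *\<^sub>v ?u))"
        by (rule cscalar_prod_mat_adjoint[OF A u Au, symmetric])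
      also have "\<dots> = 0"
        unfolding P_def by (rule orth(2)[OF v]) (use Au in \<open>auto simp: mem_col_space_iff[OF A'] P_def\<close>)
      finally have "A *\<^sub>v ?u = 0\<^sub>v n"
        using conjugate_square_eq_0_vec[OF Au] by blast
      moreover have "A *\<^sub>v ?u = A *\<^sub>v ?v - (A * P) *\<^sub>v ?v"
        by (simp only: mult_minus_distrib_mat_vec[OF A v Pv] assoc_mult_mat_vec[OF A Pc v])
      ultimately have "(A *\<^sub>v ?v - (A * P) *\<^sub>v ?v) $ i = 0"
        using ij(1) by (simp only: index_zero_vec)
      moreover have "(A *\<^sub>v ?v) $ i = A $$ (i, j)" "((A * P) *\<^sub>v ?v) $ i = (A * P) $$ (i, j)"
        using ij A mult_carrier_mat[OF A Pc] by auto
      ultimately show "(A * P) $$ (i, j) = A $$ (i, j)"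
        using ij A by simp
    qed (use A Pc in auto)
    \<comment> \<open>The versions with a trailing factor \<open>Z\<close> are rewrite rules for
      products associated to the right.\<close>
    have AP': "A * (P * Z) = A * Z" if "Z \<in> carrier_mat n n" for Z
      using assoc[OF A Pc that] AP by simp
    have XA': "X * (A * Z) = P * Z" if "Z \<in> carrier_mat n n" for Z
      using assoc[OF X A that] by (simp add: P_def)
    have XP: "X * P = X"
      using assoc[OF E A Pc] AP XE by simp
    have XP': "X * (P * Z) = X * Z" if "Z \<in> carrier_mat n n" for Z
      using assoc[OF X Pc that] XP by simp
    have PP: "P * P = P"
      using XA'[OF Pc] AP by (simp add: P_def)
    have PP': "P * (P * Z) = P * Z" if "Z \<in> carrier_mat n n" for Z
      using assoc[OF Pc Pc that] PP by simp
    have P': "mat_adjoint P \<in> carrier_mat n n" and B': "mat_adjoint B \<in> carrier_mat n n"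
      using Pc B(1) by simp_all
    \<comment> \<open>From \<open>P = ?A' * B\<close> and \<open>A * P = A\<close> it follows that
      \<open>mat_adjoint P\<close> equals \<open>mat_adjoint P * P\<close>, which is
      self-adjoint.\<close>
    have "mat_adjoint P = mat_adjoint B * A"
      unfolding P_def B(2) mat_adjoint_mult[OF A' B(1)] mat_adjoint_mat_adjoint[OF A] ..
    then have P'P: "mat_adjoint P * P = mat_adjoint P"
      using assoc[OF B' A Pc] AP by simp
    have "P = mat_adjoint P"
      using mat_adjoint_mult[OF P' Pc] mat_adjoint_mat_adjoint[OF Pc] by (simp add: P'P)
    then have PA': "P * ?A' = ?A'"
      using mat_adjoint_mult[OF A Pc] AP by simp
    \<comment> \<open>Here \<open>K = P * X\<close> and \<open>L = P * A\<close>; their product is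
      \<open>P * (X * A) = P * P = P\<close>, since \<open>X * P = X\<close>.\<close>
    have PAX: "(P * A) * (P * X) = P"
    proof (rule corner_inverse_commute[OF Pc _ _ PP])
      show "P * X * (P * A) = P"
        using Pc A X by (simp add: assoc XP' PP flip: P_def)
    qed (use Pc A X in \<open>simp_all add: assoc PP' XP AP\<close>)
    have AAX: "A = (A * A) * X"
    proof -
      \<comment> \<open>Each inner \<open>P\<close> is absorbed by the \<open>A\<close> on its
        left.\<close>
      have "A = A * ((P * A) * (P * X))" using PAX AP by simp
      also have "\<dots> = (A * A) * X" using Pc A X by (simp add: assoc AP')
      finally show ?thesis .
    qed
    have XPX: "X = P * X"
    proof -
      have "X = E * ((A * A) * X)" using XE AAX by simp
      also have "\<dots> = (E * A) * (A * X)" using E A X by (simp add: assoc)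
      also have "\<dots> = P * X" using XA'[OF X] XE by simp
      finally show ?thesis .
    qed
    have "?A' = X * (A * ?A')" using XA'[OF A'] PA' by simp
    moreover have "X = ?A' * (B * X)"
      using XPX assoc[OF A' B(1) X] B(2) by (simp add: P_def)
    ultimately have "{X * Z | Z. Z \<in> carrier_mat n n} = {?A' * Z | Z. Z \<in> carrier_mat n n}"
      using A X A' B(1)
      by (intro equalityI right_ideal_subset[of _ n "B * X"] right_ideal_subset[of _ n "A * ?A'"])
        (assumption | rule mult_carrier_mat)+
    moreover have "{Z * X | Z. Z \<in> carrier_mat n n} = {Z * A | Z. Z \<in> carrier_mat n n}"
      using A X E XE AAX
      by (intro equalityI left_ideal_subset[of _ n E] left_ideal_subset[of _ n "A * A"])
        (assumption | rule mult_carrier_mat)+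
    moreover have "A * X * A = A" using AP assoc[OF A X A] by (simp add: P_def)
    ultimately show ?R by blast
  next
    assume R: ?R
    \<comment> \<open>Choosing the identity for \<open>Z\<close> puts \<open>X\<close> into its own
      ideals, so the ideal equalities yield both factorizations of \<open>X\<close>.\<close>
    have "X \<in> {X * Z | Z. Z \<in> carrier_mat n n}"
      using X by (auto intro!: exI[of _ "1\<^sub>m n"])
    then obtain B where B: "B \<in> carrier_mat n n" "X = ?A' * B" using R by auto
    have "X \<in> {Z * X | Z. Z \<in> carrier_mat n n}"
      using X by (auto intro!: exI[of _ "1\<^sub>m n"])
    then obtain E where E: "E \<in> carrier_mat n n" "X = E * A" using R by auto
    have "?P *\<^sub>v v \<in> vec_space.col_space n ?A' \<and>
        (\<forall>w \<in> vec_space.col_space n ?A'. (v - ?P *\<^sub>v v) \<bullet>c w = 0)" if v: "v \<in> carrier_vec n" for v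
    proof
      have Av: "A *\<^sub>v v \<in> carrier_vec n" using A v by (rule mult_mat_vec_carrier)
      have "?P *\<^sub>v v = ?A' *\<^sub>v (B *\<^sub>v (A *\<^sub>v v))"
        using assoc_mult_mat_vec[OF X A v] assoc_mult_mat_vec[OF A' B(1) Av] B(2) by simp
      then show "?P *\<^sub>v v \<in> vec_space.col_space n ?A'"
        using B A v by (auto simp: mem_col_space_iff[OF A'] intro!: bexI[of _ "B *\<^sub>v (A *\<^sub>v v)"])
      have u: "v - ?P *\<^sub>v v \<in> carrier_vec n" using v P by auto
      have "A *\<^sub>v (v - ?P *\<^sub>v v) = A *\<^sub>v v - (A * X * A) *\<^sub>v v"
        using mult_minus_distrib_mat_vec[OF A v mult_mat_vec_carrier[OF P v]]
          assoc_mult_mat_vec[OF A P v] assoc[OF A X A] by simp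
      also have "\<dots> = 0\<^sub>v n" using R mult_mat_vec_carrier[OF A v] by simp
      finally have "A *\<^sub>v (v - ?P *\<^sub>v v) = 0\<^sub>v n" .
      \<comment> \<open>Writing \<open>w\<close> as \<open>?A'\<close> applied to \<open>y\<close>
        moves the adjoint onto \<open>v - ?P v\<close>, which \<open>A\<close> annihilates.\<close>
      then show "\<forall>w \<in> vec_space.col_space n ?A'. (v - ?P *\<^sub>v v) \<bullet>c w = 0"
        using cscalar_prod_mat_adjoint[OF A u] by (auto simp: mem_col_space_iff[OF A'])
    qed
    moreover have "vec_space.col_space n ?X' \<subseteq> vec_space.col_space n ?A'"
    proof
      fix y assume "y \<in> vec_space.col_space n ?X'"
      then obtain x where x: "x \<in> carrier_vec n" "y = ?X' *\<^sub>v x"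
        using mem_col_space_iff[OF X'] by auto
      have E': "mat_adjoint E \<in> carrier_mat n n" using E by simp
      \<comment> \<open>Adjoints of \<open>X = E * A\<close> give
        \<open>?X' = ?A' * mat_adjoint E\<close>.\<close>
      have "y = ?A' *\<^sub>v (mat_adjoint E *\<^sub>v x)"
        using x(2) assoc_mult_mat_vec[OF A' E' x(1)] mat_adjoint_mult[OF E(1) A] E(2) by simp
      then show "y \<in> vec_space.col_space n ?A'"
        using x E' by (auto simp: mem_col_space_iff[OF A'] intro!: bexI[of _ "mat_adjoint E *\<^sub>v x"])
    qed
    ultimately show ?L
      using X P by (simp add: is_dual_core_inverse_def is_orthogonal_projection_def)
  }
qed

end
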